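(* Let $\Theta\subseteq\mathbb{R}$ be the parameter space, $\theta_0\in\Theta$, $\Theta_0=\{\theta_0\}$, $\Theta_{-1}=\{\theta\in\Theta:\theta<\theta_0\}$, $\Theta_{1}=\{\theta\in\Theta:\theta>\theta_0\}$ and $0<\alpha<1$. Consider decision functions $\varphi$ of the data $x$ taking values in $\{-1,0,1\}$, where $\Theta_i$ is accepted if $\varphi(x)=i$, and the loss function \[ L_{(1)}(\theta,\varphi) = \begin{cases} 0, & \text{if } \theta\in\Theta_i\text{ and }\varphi=i, \quad i\in \{-1,0,1\}, \\ \alpha/2, & \text{if } \theta\notin\Theta_0 \text{ and }\varphi=0,\\ 1, & \text{if } \theta\in\Theta_{i}\cup\Theta_0 \text{ and }\varphi=-i,\quad i\in\{-1,1\}.\end{cases} \] If the (proper) posterior distribution $\pi(\theta|x)$ is absolutely continuous, symmetric and unimodal, then the Bayes test under $L_{(1)}$ is to reject $\Theta_0$ if $\theta_0$ is not contained in the $1-\alpha$ HPD set.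
   Context: The parameter $\theta$ is real-valued, with parameter space $\Theta\subseteq\mathbb{R}$; $\mathrm{P}(\cdot|x)$ denotes posterior probability given the data $x$ and $\pi(\theta|x)$ the posterior density. The $1-\alpha$ highest posterior density (HPD) set is the set $\{\theta:\pi(\theta|x)>k_\alpha\}$ of all $\theta$ for which the posterior density is greater than $k_\alpha$, where the constant $k_\alpha$ is such that this set has posterior probability $1-\alpha$. Rejecting $\Theta_0$ means $\varphi(x)\in\{-1,1\}$; accepting $\Theta_0$ means $\varphi(x)=0$. A Bayes test (Bayes decision rule) is a decision function which, for each $x$, chooses a decision minimizing the posterior expected loss $\mathrm{E}(L_{(1)}(\theta,\varphi)|x)$; if several decisions attain the minimum, any of them may be chosen. Saying that the Bayes test is to reject $\Theta_0$ if a condition holds means that the test which rejects $\Theta_0$ when the condition holds, and accepts it otherwise, is a Bayes test (upon rejection, the decision in $\{-1,1\}$ being the one with smaller posterior expected loss). *)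

theory Defs
  imports "HOL-Probability.Probability"
begin

definition hypothesis :: "real set \<Rightarrow> real \<Rightarrow> int \<Rightarrow> real set" where
  "hypothesis \<Theta> \<theta>0 i =
     (if i = 0 then {\<theta>0}
      else if i = -1 then {\<theta> \<in> \<Theta>. \<theta> < \<theta>0}
      else if i = 1 then {\<theta> \<in> \<Theta>. \<theta> > \<theta>0}
      else {})"

text \<open>
  For parameters in \<open>\<Theta>\<close> and decisions in \<open>{-1, 0, 1}\<close> the three cases are exhaustive and
  mutually exclusive, so neither the order of the tests nor the final \<open>0\<close> matters.
\<close>
definition loss1 :: "real set \<Rightarrow> real \<Rightarrow> real \<Rightarrow> real \<Rightarrow> int \<Rightarrow> real" where
  "loss1 \<Theta> \<theta>0 \<alpha> \<theta> d =
     (if \<exists>i\<in>{-1, 0, 1}. \<theta> \<in> hypothesis \<Theta> \<theta>0 i \<and> d = i then 0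
      else if \<theta> \<notin> hypothesis \<Theta> \<theta>0 0 \<and> d = 0 then \<alpha> / 2
      else if \<exists>i\<in>{-1, 1}. \<theta> \<in> hypothesis \<Theta> \<theta>0 i \<union> hypothesis \<Theta> \<theta>0 0 \<and> d = - i then 1
      else 0)"

definition expected_loss :: "real measure \<Rightarrow> (real \<Rightarrow> int \<Rightarrow> real) \<Rightarrow> int \<Rightarrow> real" where
  "expected_loss M L d = (\<integral>\<theta>. L \<theta> d \<partial>M)"

text \<open>
  \<open>X\<close> is the sample space and \<open>P x\<close> is the posterior distribution given the data \<open>x\<close>.
\<close>
definition bayes_test ::
  "'x set \<Rightarrow> ('x \<Rightarrow> real measure) \<Rightarrow> (real \<Rightarrow> int \<Rightarrow> real) \<Rightarrow> ('x \<Rightarrow> int) \<Rightarrow> bool" where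
  "bayes_test X P L \<phi> \<longleftrightarrow>
     (\<forall>x\<in>X. \<phi> x \<in> {-1, 0, 1} \<and>
        (\<forall>d\<in>{-1, 0, 1}. expected_loss (P x) L (\<phi> x) \<le> expected_loss (P x) L d))"

text \<open>
  \<open>\<phi>\<close> rejects exactly when \<open>R x\<close> holds, and then chooses between \<open>-1\<close> and \<open>1\<close> a decision of
  smaller posterior expected loss (either one in case of a tie).
\<close>
definition rejects_iff ::
  "'x set \<Rightarrow> ('x \<Rightarrow> real measure) \<Rightarrow> (real \<Rightarrow> int \<Rightarrow> real) \<Rightarrow> ('x \<Rightarrow> bool) \<Rightarrow> ('x \<Rightarrow> int) \<Rightarrow> bool" where
  "rejects_iff X P L R \<phi> \<longleftrightarrow>
     (\<forall>x\<in>X. if R x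
        then \<phi> x \<in> {-1, 1} \<and> expected_loss (P x) L (\<phi> x) \<le> expected_loss (P x) L (- \<phi> x)
        else \<phi> x = 0)"

text \<open>
  Densities take values in \<^typ>\<open>ennreal\<close>, so that a density which is unbounded near its mode can
  still be monotone up to and including the mode (with value \<open>\<infinity>\<close> there).
\<close>
definition unimodal :: "(real \<Rightarrow> ennreal) \<Rightarrow> bool" where
  "unimodal f \<longleftrightarrow> (\<exists>m. mono_on {..m} f \<and> antimono_on {m..} f)"

definition symmetric_distribution :: "real measure \<Rightarrow> bool" where
  "symmetric_distribution M \<longleftrightarrow> (\<exists>c. distr M borel (\<lambda>\<theta>. 2 * c - \<theta>) = M)"

text \<open>
  The set depends on the chosen version \<open>f\<close> of the density of \<open>M\<close>. A threshold giving
  probability exactly \<open>1 - \<alpha>\<close> need not exist, for example when \<open>f\<close> is uniform on an interval.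
\<close>
definition is_hpd_set ::
  "real set \<Rightarrow> real measure \<Rightarrow> (real \<Rightarrow> ennreal) \<Rightarrow> real \<Rightarrow> real set \<Rightarrow> bool" where
  "is_hpd_set \<Theta> M f \<alpha> H \<longleftrightarrow>
     (\<exists>k. H = {\<theta> \<in> \<Theta>. f \<theta> > k} \<and> measure M H = 1 - \<alpha>)"

end

theory Submission
  imports Defs
begin

text \<open>
  Under this loss the posterior expected losses of the decisions \<open>1\<close>, \<open>-1\<close> and \<open>0\<close> are
  \<open>P(\<theta> \<le> \<theta>\<^sub>0)\<close>, \<open>P(\<theta> \<ge> \<theta>\<^sub>0)\<close> and \<open>\<alpha>/2\<close> (\<open>expected_loss1\<close>), so a Bayes test rejects when the
  smaller of the two tails at \<open>\<theta>\<^sub>0\<close> has probability below \<open>\<alpha>/2\<close>, accepts when it is above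
  \<open>\<alpha>/2\<close>, and may do either at equality.

  Up to a null set, the HPD set is an equal-tailed credible interval. By unimodality the superlevel set
  \<open>A = {\<pi> > k}\<close> is an interval, so its complement consists of the part \<open>strictly_below A\<close>
  and the part \<open>strictly_above A\<close>. Symmetry of the distribution makes the density, and hence \<open>A\<close>,
  almost everywhere invariant under reflection (\<open>symmetric_density_AE\<close>). An interval with this property and positive
  probability contains a point together with its mirror image, so the reflection exchanges the two
  parts of the complement up to a null set, and each has probability \<open>\<alpha>/2\<close> (\<open>interval_equal_tails\<close>).

  If \<open>\<theta>\<^sub>0 \<notin> A\<close>, then \<open>\<theta>\<^sub>0\<close> lies on one side of \<open>A\<close>, and the tail at \<open>\<theta>\<^sub>0\<close> pointing away from \<open>A\<close> is
  contained in a part of probability \<open>\<alpha>/2\<close>. If \<open>\<theta>\<^sub>0 \<in> A\<close>, then each tail at \<open>\<theta>\<^sub>0\<close> contains one of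
  the two parts. Comparing with \<open>\<alpha>/2\<close> gives the claim (\<open>hpd_tail_bounds\<close>).

  The two parts of the complement are described by strict bounds of \<open>A\<close> instead of its endpoints, which
  treats open, half-open and unbounded intervals uniformly.
\<close>

section \<open>Equal tails of intervals under a symmetric distribution\<close>

definition strictly_below :: "real set \<Rightarrow> real set" where
  "strictly_below A = {x. \<forall>y\<in>A. x < y}"

definition strictly_above :: "real set \<Rightarrow> real set" where
  "strictly_above A = {x. \<forall>y\<in>A. y < x}"

lemma strictly_below_borel [measurable]: "strictly_below A \<in> sets borel"
  by (rule real_interval_borel_measurable) (unfold is_interval_1 strictly_below_def, blast intro: le_less_trans)

lemma strictly_above_borel [measurable]: "strictly_above A \<in> sets borel"
  by (rule real_interval_borel_measurable) (unfold is_interval_1 strictly_above_def, blast intro: less_le_trans)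

lemma interval_trichotomy:
  assumes "is_interval A"
  shows "x \<in> A \<or> x \<in> strictly_below A \<or> x \<in> strictly_above A"
  using assms unfolding is_interval_1 strictly_below_def strictly_above_def mem_Collect_eq
  by (meson not_le less_imp_le)

lemma unimodal_superlevel_interval:
  assumes "unimodal f"
  shows "is_interval {x. k < f x}"
proof -
  from assms obtain m where up: "mono_on {..m} f" and down: "antimono_on {m..} f"
    by (auto simp: unimodal_def)
  have "k < f x" if "k < f a" "k < f b" "a \<le> x" "x \<le> b" for a b x
  proof (cases "x \<le> m")
    case True
    then have "f a \<le> f x" using up that by (auto simp: monotone_on_def)
    with that show ?thesis by order
  next
    case False
    then have "f b \<le> f x" using down that by (auto simp: monotone_on_def)
    with that show ?thesis by order
  qed
  then show ?thesis unfolding is_interval_1 by blast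
qed

text \<open>
  Reflecting \<open>density lborel f\<close> gives the density \<open>f (2 * c - x)\<close>, since Lebesgue measure is
  invariant under reflection; densities of one measure agree almost everywhere.
\<close>
lemma symmetric_density_AE:
  fixes c :: real
  assumes f: "f \<in> borel_measurable borel"
    and sym: "distr (density lborel f) borel (\<lambda>x. 2 * c - x) = density lborel f"
  shows "AE x in lborel. f (2 * c - x) = f x"
proof -
  have refl: "distr lborel borel (\<lambda>x. 2 * c - x) = (lborel :: real measure)"
    by (subst (2) lborel_real_affine[of "-1" "2 * c"])
       (auto simp: density_1 one_ennreal_def[symmetric])
  have "density lborel (\<lambda>x. f (2 * c - x))
      = density (distr lborel borel (\<lambda>x. 2 * c - x)) (\<lambda>x. f (2 * c - x))"
    by (simp add: refl)
  also have "\<dots> = distr (density lborel (\<lambda>x. f (2 * c - (2 * c - x)))) borel (\<lambda>x. 2 * c - x)"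
    using f by (subst density_distr) auto
  also have "\<dots> = density lborel f"
    using sym by simp
  finally show ?thesis
    using f by (intro sigma_finite_measure.density_unique[OF sigma_finite_lborel]) auto
qed

text \<open>
  Since \<open>A\<close> is almost everywhere symmetric and has positive probability, it contains some \<open>y\<close>
  together with its mirror image. A point on one side of \<open>A\<close> whose mirror
  image also avoids \<open>A\<close> must therefore have it on the other side.
\<close>
lemma interval_equal_tails:
  assumes "prob_space M" and sets: "sets M = sets borel"
    and A: "is_interval A" and pos: "measure M A > 0"
    and sym: "distr M borel (\<lambda>x. 2 * c - x) = M"
    and AE_sym: "AE x in M. 2 * c - x \<in> A \<longleftrightarrow> x \<in> A"
  shows "measure M (strictly_below A) = (1 - measure M A) / 2"
    and "measure M (strictly_above A) = (1 - measure M A) / 2"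
proof -
  interpret prob_space M by fact
  note [measurable_cong] = sets
  have [measurable]: "A \<in> sets borel"
    using A by (rule real_interval_borel_measurable)
  have sp: "space M = UNIV"
    using sets sets_eq_imp_space_eq by fastforce
  obtain y where y: "y \<in> A" "2 * c - y \<in> A"
  proof (rule ccontr)
    assume "\<not> thesis"
    with that AE_sym have "AE x in M. x \<notin> A" by auto
    then have "measure M A = 0"
      by (subst prob_eq_0) auto
    with pos show False by simp
  qed
  have "AE x in M. x \<in> strictly_below A \<longleftrightarrow> 2 * c - x \<in> strictly_above A"
    using AE_sym
  proof eventually_elim
    case (elim x)
    show ?case
    proof
      assume x: "x \<in> strictly_below A"
      then have "2 * c - x \<notin> A" using elim by (auto simp: strictly_below_def)
      moreover have "2 * c - x \<notin> strictly_below A" using x y by (force simp: strictly_below_def)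
      ultimately show "2 * c - x \<in> strictly_above A" using interval_trichotomy[OF A] by blast
    next
      assume x: "2 * c - x \<in> strictly_above A"
      then have "x \<notin> A" using elim by (auto simp: strictly_above_def)
      moreover have "x \<notin> strictly_above A" using x y by (force simp: strictly_above_def)
      ultimately show "x \<in> strictly_below A" using interval_trichotomy[OF A] by blast
    qed
  qed
  moreover have "(\<lambda>x. 2 * c - x) -` strictly_above A \<inter> space M \<in> sets M"
    by measurable
  ultimately have "measure M (strictly_below A) = measure M ((\<lambda>x. 2 * c - x) -` strictly_above A \<inter> space M)"
    by (intro measure_eq_AE) (auto simp: sp)
  also have "\<dots> = measure (distr M borel (\<lambda>x. 2 * c - x)) (strictly_above A)"
    by (rule measure_distr[symmetric]) auto
  finally have eq: "measure M (strictly_below A) = measure M (strictly_above A)"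
    using sym by simp
  have "strictly_below A \<inter> strictly_above A = {}" "(strictly_below A \<union> strictly_above A) \<inter> A = {}"
    using y by (force simp: strictly_below_def strictly_above_def)+
  then have "measure M (strictly_below A \<union> strictly_above A \<union> A) = measure M (strictly_below A) + measure M (strictly_above A) + measure M A"
    by (simp add: finite_measure_Union sets)
  moreover have "strictly_below A \<union> strictly_above A \<union> A = space M"
    using interval_trichotomy[OF A] by (auto simp: sp)
  ultimately show "measure M (strictly_below A) = (1 - measure M A) / 2"
      "measure M (strictly_above A) = (1 - measure M A) / 2"
    using eq prob_space by simp_all
qed

section \<open>Tail probabilities at a point inside or outside the HPD set\<close>

lemma prob_AE_mem:
  assumes "prob_space M" and "measure M S = 1"
  shows "AE x in M. x \<in> S"
proof -
  interpret prob_space M by fact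
  have "S \<in> sets M"
    using assms(2) measure_notin_sets by force
  then show ?thesis
    using assms(2) prob_eq_1 by blast
qed

lemma hpd_tail_bounds:
  assumes prob: "prob_space M" and full: "measure M \<Theta> = 1" and \<theta>: "\<theta> \<in> \<Theta>"
    and \<alpha>: "\<alpha> < 1"
    and f: "f \<in> borel_measurable borel" and M: "M = density lborel f"
    and "symmetric_distribution M" and "unimodal f" and "is_hpd_set \<Theta> M f \<alpha> H"
  shows "\<theta> \<in> H \<Longrightarrow> \<alpha> / 2 \<le> measure M {..\<theta>}"
    and "\<theta> \<in> H \<Longrightarrow> \<alpha> / 2 \<le> measure M {\<theta>..}"
    and "\<theta> \<notin> H \<Longrightarrow> measure M {..\<theta>} \<le> \<alpha> / 2 \<or> measure M {\<theta>..} \<le> \<alpha> / 2"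
proof -
  interpret prob_space M by fact
  have sets: "sets M = sets borel" by (simp add: M)
  note [measurable] = f
  obtain k where H: "H = {\<theta> \<in> \<Theta>. k < f \<theta>}" and mH: "measure M H = 1 - \<alpha>"
    using assms by (auto simp: is_hpd_set_def)
  obtain c where c: "distr M borel (\<lambda>x. 2 * c - x) = M"
    using assms by (auto simp: symmetric_distribution_def)
  define A where "A = {x. k < f x}"
  have A: "is_interval A"
    using unimodal_superlevel_interval[OF \<open>unimodal f\<close>] by (simp add: A_def)
  have [measurable]: "A \<in> sets borel" by (simp add: A_def)
  have "\<Theta> \<in> sets M" using full measure_notin_sets by force
  \<comment> \<open>\<open>\<Theta>\<close> need not be an interval, so the argument runs on \<open>A\<close>, which differs from \<open>H\<close> by a null set.\<close>
  moreover have "H = \<Theta> \<inter> A" by (auto simp: H A_def)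
  ultimately have "H \<in> sets M" by (auto simp: sets)
  then have "measure M A = measure M H"
    using prob_AE_mem[OF prob full] by (intro measure_eq_AE) (auto simp: sets H A_def)
  then have mA: "measure M A = 1 - \<alpha>" using mH by simp
  have "AE x in lborel. f (2 * c - x) = f x"
    using symmetric_density_AE[OF f c[unfolded M]] .
  then have "AE x in lborel. 0 < f x \<longrightarrow> (2 * c - x \<in> A \<longleftrightarrow> x \<in> A)"
    by eventually_elim (simp add: A_def)
  then have "AE x in M. 2 * c - x \<in> A \<longleftrightarrow> x \<in> A"
    unfolding M using f by (subst AE_density) simp_all
  moreover have "measure M A > 0"
    using mA \<alpha> by simp
  ultimately have tails: "measure M (strictly_below A) = \<alpha> / 2" "measure M (strictly_above A) = \<alpha> / 2"
    using interval_equal_tails[OF prob sets A _ c] by (simp_all add: mA)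
  have le: "measure M S \<le> measure M T" if "S \<subseteq> T" "T \<in> sets borel" for S T
    using that sets by (intro finite_measure_mono) auto
  show "\<alpha> / 2 \<le> measure M {..\<theta>}" if "\<theta> \<in> H"
  proof -
    have "strictly_below A \<subseteq> {..\<theta>}"
      using that by (force simp: H A_def strictly_below_def)
    from le[OF this] show ?thesis by (simp add: tails)
  qed
  show "\<alpha> / 2 \<le> measure M {\<theta>..}" if "\<theta> \<in> H"
  proof -
    have "strictly_above A \<subseteq> {\<theta>..}"
      using that by (force simp: H A_def strictly_above_def)
    from le[OF this] show ?thesis by (simp add: tails)
  qed
  show "measure M {..\<theta>} \<le> \<alpha> / 2 \<or> measure M {\<theta>..} \<le> \<alpha> / 2" if "\<theta> \<notin> H"
  proof -
    have "\<theta> \<in> strictly_below A \<or> \<theta> \<in> strictly_above A"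
      using interval_trichotomy[OF A, of \<theta>] that \<theta> by (auto simp: H A_def)
    then have "{..\<theta>} \<subseteq> strictly_below A \<or> {\<theta>..} \<subseteq> strictly_above A"
      by (force simp: strictly_below_def strictly_above_def)
    then show ?thesis
      using le[of "{..\<theta>}" "strictly_below A"] le[of "{\<theta>..}" "strictly_above A"] by (auto simp: tails)
  qed
qed

section \<open>Posterior expected losses\<close>

lemma loss1_simps:
  "loss1 \<Theta> \<theta>0 \<alpha> \<theta> 0 = (if \<theta> = \<theta>0 then 0 else \<alpha> / 2)"
  "loss1 \<Theta> \<theta>0 \<alpha> \<theta> 1 = (if \<theta> = \<theta>0 \<or> \<theta> \<in> \<Theta> \<and> \<theta> < \<theta>0 then 1 else 0)"
  "loss1 \<Theta> \<theta>0 \<alpha> \<theta> (-1) = (if \<theta> = \<theta>0 \<or> \<theta> \<in> \<Theta> \<and> \<theta> > \<theta>0 then 1 else 0)"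
  by (simp_all add: loss1_def hypothesis_def)

text \<open>
  Almost every \<open>\<theta>\<close> lies in \<open>\<Theta> - {\<theta>0}\<close>. On that set accepting costs the constant \<open>\<alpha> / 2\<close>, and a
  directional decision costs \<open>1\<close> exactly when \<open>\<theta>\<close> lies on the side of \<open>\<theta>0\<close> opposite to the decision.
\<close>
lemma expected_loss1:
  assumes prob: "prob_space M" and full: "measure M \<Theta> = 1"
    and sets: "sets M = sets borel" and null: "AE \<theta> in M. \<theta> \<noteq> \<theta>0"
  shows "expected_loss M (loss1 \<Theta> \<theta>0 \<alpha>) 0 = \<alpha> / 2"
    and "expected_loss M (loss1 \<Theta> \<theta>0 \<alpha>) 1 = measure M {..\<theta>0}"
    and "expected_loss M (loss1 \<Theta> \<theta>0 \<alpha>) (-1) = measure M {\<theta>0..}"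
proof -
  interpret prob_space M by fact
  note [measurable_cong] = sets
  note ae = prob_AE_mem[OF prob full] null
  have sp: "space M = UNIV"
    using sets sets_eq_imp_space_eq by fastforce
  have [measurable]: "\<Theta> \<in> sets borel"
    using full measure_notin_sets sets by force
  have "expected_loss M (loss1 \<Theta> \<theta>0 \<alpha>) 0 = (\<integral>\<theta>. \<alpha> / 2 \<partial>M)"
    unfolding expected_loss_def loss1_simps
  proof (rule integral_cong_AE)
    show "AE \<theta> in M. (if \<theta> = \<theta>0 then 0 else \<alpha> / 2) = \<alpha> / 2"
      using null by eventually_elim simp
  qed measurable
  then show "expected_loss M (loss1 \<Theta> \<theta>0 \<alpha>) 0 = \<alpha> / 2"
    using prob_space by simp
  have "expected_loss M (loss1 \<Theta> \<theta>0 \<alpha>) 1 = (\<integral>\<theta>. indicator {..\<theta>0} \<theta> \<partial>M)"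
    unfolding expected_loss_def loss1_simps
  proof (rule integral_cong_AE)
    show "AE \<theta> in M. (if \<theta> = \<theta>0 \<or> \<theta> \<in> \<Theta> \<and> \<theta> < \<theta>0 then 1 else 0) = (indicator {..\<theta>0} \<theta> :: real)"
      using ae by eventually_elim (simp add: indicator_def)
  qed measurable
  then show "expected_loss M (loss1 \<Theta> \<theta>0 \<alpha>) 1 = measure M {..\<theta>0}"
    by (simp add: sp)
  have "expected_loss M (loss1 \<Theta> \<theta>0 \<alpha>) (-1) = (\<integral>\<theta>. indicator {\<theta>0..} \<theta> \<partial>M)"
    unfolding expected_loss_def loss1_simps
  proof (rule integral_cong_AE)
    show "AE \<theta> in M. (if \<theta> = \<theta>0 \<or> \<theta> \<in> \<Theta> \<and> \<theta> > \<theta>0 then 1 else 0) = (indicator {\<theta>0..} \<theta> :: real)"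
      using ae by eventually_elim (simp add: indicator_def)
  qed measurable
  then show "expected_loss M (loss1 \<Theta> \<theta>0 \<alpha>) (-1) = measure M {\<theta>0..}"
    by (simp add: sp)
qed

section \<open>Optimality of the HPD test\<close>

theorem corollary1:
  fixes \<Theta> :: "real set" and \<theta>0 \<alpha> :: real
    and X :: "'x set"
    and P :: "'x \<Rightarrow> real measure"
    and \<pi> :: "'x \<Rightarrow> real \<Rightarrow> ennreal"
    and H :: "'x \<Rightarrow> real set"
    and \<phi> :: "'x \<Rightarrow> int"
  assumes "\<theta>0 \<in> \<Theta>" and "0 < \<alpha>" and "\<alpha> < 1"
    and "\<And>x. x \<in> X \<Longrightarrow> prob_space (P x)"
    and "\<And>x. x \<in> X \<Longrightarrow> measure (P x) \<Theta> = 1"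
    and "\<And>x. x \<in> X \<Longrightarrow> \<pi> x \<in> borel_measurable borel"
    and "\<And>x. x \<in> X \<Longrightarrow> P x = density lborel (\<pi> x)"
    and "\<And>x. x \<in> X \<Longrightarrow> symmetric_distribution (P x)"
    and "\<And>x. x \<in> X \<Longrightarrow> unimodal (\<pi> x)"
    and "\<And>x. x \<in> X \<Longrightarrow> is_hpd_set \<Theta> (P x) (\<pi> x) \<alpha> (H x)"
    and "rejects_iff X P (loss1 \<Theta> \<theta>0 \<alpha>) (\<lambda>x. \<theta>0 \<notin> H x) \<phi>"
  shows "bayes_test X P (loss1 \<Theta> \<theta>0 \<alpha>) \<phi>"
  unfolding bayes_test_def
proof
  fix x assume x: "x \<in> X"
  have "AE \<theta> in lborel. \<theta> \<noteq> \<theta>0"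
    by (rule AE_lborel_singleton)
  then have null: "AE \<theta> in P x. \<theta> \<noteq> \<theta>0"
    unfolding assms(7)[OF x] using assms(6)[OF x] by (subst AE_density) auto
  have "sets (P x) = sets borel"
    using assms(7)[OF x] by simp
  note cost = expected_loss1[OF assms(4,5)[OF x] this null]
  note bounds = hpd_tail_bounds[OF assms(4,5)[OF x] \<open>\<theta>0 \<in> \<Theta>\<close> \<open>\<alpha> < 1\<close> assms(6-10)[OF x]]
  have rej: "if \<theta>0 \<notin> H x
      then \<phi> x \<in> {-1, 1} \<and> expected_loss (P x) (loss1 \<Theta> \<theta>0 \<alpha>) (\<phi> x)
        \<le> expected_loss (P x) (loss1 \<Theta> \<theta>0 \<alpha>) (- \<phi> x)
      else \<phi> x = 0"
    using assms(11) x by (auto simp: rejects_iff_def)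
  show "\<phi> x \<in> {-1, 0, 1} \<and> (\<forall>d\<in>{-1, 0, 1}.
      expected_loss (P x) (loss1 \<Theta> \<theta>0 \<alpha>) (\<phi> x) \<le> expected_loss (P x) (loss1 \<Theta> \<theta>0 \<alpha>) d)"
  proof (cases "\<theta>0 \<in> H x")
    case True
    then show ?thesis
      using rej bounds(1,2) by (auto simp: cost)
  next
    case False
    then show ?thesis
      using rej bounds(3) by (auto simp: cost)
  qed
qed

end
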